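(* Let $Z$ be a Polish space, $\lambda\in\mathcal P(Z)$ a Borel probability measure and $f:Z\to[0,+\infty]$ a lower semicontinuous function. Define $$\tilde f(z):=\sup\{t\in\mathbb R:\ \exists r>0\ \text{s.t.}\ \lambda(B_r(z)\cap\{f>t\})=\lambda(B_r(z))\}.$$ Then: (1) $\tilde f(z)=+\infty$ if $z\notin\operatorname{spt}\lambda$; (2) $f(z)\le\tilde f(z)$ for every $z\in Z$; (3) if $f$ is $\lambda$-integrable, then $f(z)=\tilde f(z)$ for $\lambda$-a.e. $z$; (4) $\tilde f$ is lower semicontinuous.
   Context: $B_r(z)$ is the open ball of radius $r$ centered at $z$ for a fixed complete metric inducing the topology of $Z$; $\operatorname{spt}\lambda$ is the support of $\lambda$. *)

theory Defs
  imports "HOL-Probability.Probability"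
begin

definition lower_semicont :: "('a::topological_space \<Rightarrow> 'b::linorder) \<Rightarrow> bool" where
  "lower_semicont g \<longleftrightarrow> (\<forall>t. open {z. t < g z})"

definition spt :: "'a::topological_space measure \<Rightarrow> 'a set" where
  "spt M = {z. \<forall>U. open U \<and> z \<in> U \<longrightarrow> emeasure M U > 0}"

text \<open>
  The supremum ranges over all real thresholds, negative ones included, so it is taken in
  \<^typ>\<open>ereal\<close>. The balls are those of the metric carried by the type.
\<close>

definition ftilde :: "'a::metric_space measure \<Rightarrow> ('a \<Rightarrow> ennreal) \<Rightarrow> 'a \<Rightarrow> ereal" where
  "ftilde M f z = Sup {ereal t |t. \<exists>r>0.
     emeasure M (ball z r \<inter> {w. enn2ereal (f w) > ereal t}) = emeasure M (ball z r)}"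

end

theory Submission
  imports Defs
begin

text \<open>
  For real \<open>t\<close> let \<open>U t\<close> be the set of points having a ball on which \<open>f > t\<close> almost everywhere.
  These sets are open and decrease in \<open>t\<close>, and \<open>ftilde M f z > c\<close> iff \<open>z \<in> U t\<close> for some \<open>t > c\<close>;
  this gives lower semicontinuity. By Lindelof, \<open>f > t\<close> almost everywhere on all of \<open>U t\<close>, and
  \<open>{f < ftilde M f}\<close> is covered by the null sets \<open>U q \<inter> {f \<le> q}\<close> with \<open>q\<close> rational.
\<close>

definition locally_ae_above :: "'a::metric_space measure \<Rightarrow> ('a \<Rightarrow> ennreal) \<Rightarrow> real \<Rightarrow> 'a set" where
  "locally_ae_above M f t =
     {z. \<exists>r>0. emeasure M (ball z r - {w. ereal t < enn2ereal (f w)}) = 0}"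

text \<open>Semicontinuity of \<open>f\<close> concerns thresholds in \<open>ennreal\<close>,
  whereas \<open>ftilde\<close> uses real ones. A negative threshold gives the whole space; any
  other is the image of \<open>ennreal t\<close>.\<close>

lemma open_superlevel:
  assumes "lower_semicont f"
  shows "open {w. ereal t < enn2ereal (f w)}"
proof (cases "t < 0")
  case True
  then have "ereal t < enn2ereal (f w)" for w
    by (intro less_le_trans[OF _ enn2ereal_nonneg]) simp
  then show ?thesis by simp
next
  case False
  then have "{w. ereal t < enn2ereal (f w)} = {w. ennreal t < f w}"
    unfolding less_ennreal.rep_eq by (simp only: enn2ereal_ennreal not_less)
  then show ?thesis using assms by (simp add: lower_semicont_def)
qed

text \<open>Finiteness allows cancelling the measure of \<open>B \<inter> A\<close>. This turns the
  equality of measures in \<open>ftilde\<close> into a null-set condition, which passes to smaller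
  sets.\<close>

lemma (in finite_measure) emeasure_Int_eq_iff_Diff_null:
  assumes "A \<in> sets M" "B \<in> sets M"
  shows "emeasure M (B \<inter> A) = emeasure M B \<longleftrightarrow> emeasure M (B - A) = 0"
proof -
  have "measure M B = measure M (B \<inter> A) + measure M (B - A)"
    using finite_measure_Diff'[of B A] assms by simp
  then show ?thesis by (simp add: emeasure_eq_measure)
qed

lemma ftilde_eq_Sup_locally_ae_above:
  assumes "finite_measure M" "sets M = sets borel" "lower_semicont f"
  shows "ftilde M f z = Sup {ereal t |t. z \<in> locally_ae_above M f t}"
proof -
  interpret finite_measure M by fact
  have "emeasure M (ball z r \<inter> {w. ereal t < enn2ereal (f w)}) = emeasure M (ball z r)
      \<longleftrightarrow> emeasure M (ball z r - {w. ereal t < enn2ereal (f w)}) = 0" for t r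
    using assms open_superlevel[OF assms(3)] by (intro emeasure_Int_eq_iff_Diff_null) auto
  then show ?thesis by (simp add: ftilde_def locally_ae_above_def)
qed

lemma less_ftilde_iff:
  assumes "finite_measure M" "sets M = sets borel" "lower_semicont f"
  shows "c < ftilde M f z \<longleftrightarrow> (\<exists>t. c < ereal t \<and> z \<in> locally_ae_above M f t)"
  unfolding ftilde_eq_Sup_locally_ae_above[OF assms] less_Sup_iff by auto

lemma locally_ae_above_antimono:
  assumes "sets M = sets borel" "lower_semicont f" "s \<le> t"
  shows "locally_ae_above M f t \<subseteq> locally_ae_above M f s"
proof
  fix z assume "z \<in> locally_ae_above M f t"
  then obtain r where r: "r > 0" "emeasure M (ball z r - {w. ereal t < enn2ereal (f w)}) = 0"
    by (auto simp: locally_ae_above_def)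
  have "ball z r - {w. ereal t < enn2ereal (f w)} \<in> sets M"
    using assms(1) open_superlevel[OF assms(2)] by auto
  moreover have "ball z r - {w. ereal s < enn2ereal (f w)}
      \<subseteq> ball z r - {w. ereal t < enn2ereal (f w)}"
    using assms(3) by (auto intro: le_less_trans[of "ereal s" "ereal t"])
  ultimately have "emeasure M (ball z r - {w. ereal s < enn2ereal (f w)}) = 0"
    using r(2) emeasure_eq_0 by blast
  with r(1) show "z \<in> locally_ae_above M f s" by (auto simp: locally_ae_above_def)
qed

text \<open>A ball that works for its centre works for each of its points, since a smaller ball
  around the point fits inside. Openness follows.\<close>

lemma ball_subset_locally_ae_above:
  assumes "sets M = sets borel" "lower_semicont f"
    and "emeasure M (ball z r - {w. ereal t < enn2ereal (f w)}) = 0"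
  shows "ball z r \<subseteq> locally_ae_above M f t"
proof
  fix y assume "y \<in> ball z r"
  then obtain e where e: "e > 0" "ball y e \<subseteq> ball z r"
    using open_ball[of z r] unfolding open_contains_ball by blast
  have "ball z r - {w. ereal t < enn2ereal (f w)} \<in> sets M"
    using assms(1) open_superlevel[OF assms(2)] by auto
  then have "emeasure M (ball y e - {w. ereal t < enn2ereal (f w)}) = 0"
    using assms(3) e(2) by (rule emeasure_eq_0[OF _ _ Diff_mono]) simp
  with e(1) show "y \<in> locally_ae_above M f t" by (auto simp: locally_ae_above_def)
qed

lemma open_locally_ae_above:
  assumes "sets M = sets borel" "lower_semicont f"
  shows "open (locally_ae_above M f t)"
  unfolding open_contains_ball
proof
  fix z assume "z \<in> locally_ae_above M f t"
  then obtain r where "r > 0" "emeasure M (ball z r - {w. ereal t < enn2ereal (f w)}) = 0"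
    by (auto simp: locally_ae_above_def)
  with ball_subset_locally_ae_above[OF assms] show "\<exists>r>0. ball z r \<subseteq> locally_ae_above M f t"
    by blast
qed

text \<open>The set is a union of possibly uncountably many balls, each with a null exceptional set.
  Second countability leaves countably many balls with the same union, so the exceptional sets add
  up to a null set.\<close>

lemma AE_locally_ae_above:
  fixes M :: "'a::{metric_space, second_countable_topology} measure"
  assumes "sets M = sets borel" "lower_semicont f"
  shows "AE z in M. z \<in> locally_ae_above M f t \<longrightarrow> ereal t < enn2ereal (f z)"
proof -
  define A where "A = {w. ereal t < enn2ereal (f w)}"
  \<comment> \<open>Radii are unrestricted here: a nonpositive one only contributes the empty
    set.\<close>
  define F where "F = {ball z r |z r. emeasure M (ball z r - A) = 0}"
  obtain F' where F': "F' \<subseteq> F" "countable F'" "\<Union>F' = \<Union>F"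
    by (rule Lindelof[of F]) (auto simp: F_def)
  have "B - A \<in> null_sets M" if "B \<in> F'" for B
  proof -
    from that F'(1) have "B \<in> F" by blast
    then obtain z r where "B = ball z r" "emeasure M (B - A) = 0" by (auto simp: F_def)
    moreover have "A \<in> sets M" using open_superlevel[OF assms(2), of t] assms(1) by (simp add: A_def)
    ultimately show ?thesis using assms(1) by (intro null_setsI) auto
  qed
  then have "(\<Union>B\<in>F'. B - A) \<in> null_sets M"
    using F'(2) by (intro null_sets_UN') auto
  moreover have "{z \<in> space M. \<not> (z \<in> locally_ae_above M f t \<longrightarrow> ereal t < enn2ereal (f z))}
      \<subseteq> (\<Union>B\<in>F'. B - A)"
  proof
    fix z assume "z \<in> {z \<in> space M. \<not> (z \<in> locally_ae_above M f t \<longrightarrow> ereal t < enn2ereal (f z))}"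
    then have "z \<in> locally_ae_above M f t" "z \<notin> A" by (auto simp: A_def)
    then obtain r where "r > 0" "emeasure M (ball z r - A) = 0"
      by (auto simp: locally_ae_above_def A_def)
    then have "z \<in> ball z r" "ball z r \<in> F" by (auto simp: F_def)
    then have "z \<in> \<Union>F'" unfolding F'(3) by blast
    with \<open>z \<notin> A\<close> show "z \<in> (\<Union>B\<in>F'. B - A)" by blast
  qed
  ultimately show ?thesis by (rule AE_I')
qed

text \<open>A ball inside a null neighbourhood makes every real threshold admissible, so the
  supremum is infinite.\<close>

lemma ftilde_outside_spt:
  assumes "finite_measure M" "sets M = sets borel" "lower_semicont f" "z \<notin> spt M"
  shows "ftilde M f z = \<infinity>"
proof -
  from assms(4) obtain U where U: "open U" "z \<in> U" "emeasure M U = 0"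
    by (auto simp: spt_def)
  then obtain r where r: "r > 0" "ball z r \<subseteq> U"
    by (auto simp: open_contains_ball)
  have "U \<in> sets M" using U(1) assms(2) by simp
  then have "emeasure M (ball z r - {w. ereal t < enn2ereal (f w)}) = 0" for t
    using U(3) r(2) by (rule emeasure_eq_0[OF _ _ subset_trans[OF Diff_subset]])
  with r(1) have "z \<in> locally_ae_above M f t" for t
    by (auto simp: locally_ae_above_def)
  then have "ereal t \<le> ftilde M f z" for t
    unfolding ftilde_eq_Sup_locally_ae_above[OF assms(1-3)] by (intro Sup_upper) auto
  then show ?thesis by (rule ereal_top)
qed

text \<open>Every real \<open>t\<close> below \<open>f z\<close> is admissible: the open superlevel
  set contains a whole ball around \<open>z\<close>, so the exceptional set is empty.\<close>

lemma le_ftilde: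
  assumes "finite_measure M" "sets M = sets borel" "lower_semicont f"
  shows "enn2ereal (f z) \<le> ftilde M f z"
proof (rule dense_le)
  fix c assume "c < enn2ereal (f z)"
  then obtain t where t: "c < ereal t" "ereal t < enn2ereal (f z)"
    using ereal_dense2 by blast
  then obtain r where r: "r > 0" "ball z r \<subseteq> {w. ereal t < enn2ereal (f w)}"
    using open_superlevel[OF assms(3), of t] by (auto simp: open_contains_ball)
  from r(2) have "ball z r - {w. ereal t < enn2ereal (f w)} = {}" by (simp only: Diff_eq_empty_iff)
  then have "emeasure M (ball z r - {w. ereal t < enn2ereal (f w)}) = 0"
    by (simp only: emeasure_empty)
  with r(1) have "z \<in> locally_ae_above M f t"
    unfolding locally_ae_above_def by blast
  with t(1) show "c \<le> ftilde M f z"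
    using less_ftilde_iff[OF assms] less_imp_le by blast
qed

lemma AE_eq_ftilde:
  fixes M :: "'a::{metric_space, second_countable_topology} measure"
  assumes "finite_measure M" "sets M = sets borel" "lower_semicont f"
  shows "AE z in M. enn2ereal (f z) = ftilde M f z"
proof -
  \<comment> \<open>Rational thresholds keep the union of exceptional null sets countable.\<close>
  have "AE z in M. \<forall>q. z \<in> locally_ae_above M f (real_of_rat q) \<longrightarrow>
      ereal (real_of_rat q) < enn2ereal (f z)"
    unfolding AE_all_countable by (intro allI AE_locally_ae_above[OF assms(2,3)])
  then show ?thesis
  proof eventually_elim
    case (elim z)
    have "ftilde M f z \<le> enn2ereal (f z)"
    proof (rule ccontr)
      assume "\<not> ?thesis"
      then obtain t where t: "enn2ereal (f z) < ereal t" "z \<in> locally_ae_above M f t"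
        using less_ftilde_iff[OF assms] unfolding not_le by blast
      \<comment> \<open>The real \<open>s\<close> replaces the extended real
        \<open>enn2ereal (f z)\<close>, so that density of the rationals in the reals
        applies.\<close>
      then obtain s where s: "enn2ereal (f z) < ereal s" "ereal s < ereal t"
        using ereal_dense2 by blast
      then obtain q where q: "s < real_of_rat q" "real_of_rat q < t"
        using of_rat_dense[of s t] by auto
      then have "z \<in> locally_ae_above M f (real_of_rat q)"
        using locally_ae_above_antimono[OF assms(2,3), of "real_of_rat q" t] t(2) by auto
      with elim have "ereal (real_of_rat q) < enn2ereal (f z)" by blast
      also note s(1)
      finally show False using q(1) by simp
    qed
    with le_ftilde[OF assms] show ?case by (intro antisym)
  qed
qed

lemma lower_semicont_ftilde:
  assumes "finite_measure M" "sets M = sets borel" "lower_semicont f"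
  shows "lower_semicont (ftilde M f)"
  unfolding lower_semicont_def
proof
  fix c
  \<comment> \<open>Here \<open>c\<close> is an extended real; for \<open>c = \<infinity>\<close> no
    real \<open>t\<close> qualifies and the union is empty.\<close>
  have "{z. c < ftilde M f z} = (\<Union>t\<in>{t. c < ereal t}. locally_ae_above M f t)"
    by (simp add: less_ftilde_iff[OF assms] set_eq_iff)
  then show "open {z. c < ftilde M f z}"
    using open_locally_ae_above[OF assms(2,3)] by auto
qed

theorem theoremD1:
  fixes M :: "'a::polish_space measure"
    and f :: "'a \<Rightarrow> ennreal"
  assumes "prob_space M"
    and "sets M = sets borel"
    and "lower_semicont f"
  shows "(\<forall>z. z \<notin> spt M \<longrightarrow> ftilde M f z = \<infinity>)
    \<and> (\<forall>z. enn2ereal (f z) \<le> ftilde M f z)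
    \<and> ((\<integral>\<^sup>+ z. f z \<partial>M) < \<infinity> \<longrightarrow> (AE z in M. enn2ereal (f z) = ftilde M f z))
    \<and> lower_semicont (ftilde M f)"
proof -
  interpret prob_space M by fact
  note * = finite_measure_axioms assms(2,3)
  show ?thesis
    using ftilde_outside_spt[OF *] le_ftilde[OF *] AE_eq_ftilde[OF *] lower_semicont_ftilde[OF *]
    by blast
qed

end
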